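(* Let $\Lambda\subset\mathbb{N}_0^d$ be an arbitrary finite index set. A rank-1 lattice rule $Q_n^*$ with $n$ points and generating vector $\boldsymbol{z}\in\mathbb{Z}^d$ reconstructs exactly the Chebyshev coefficients of all Chebyshev space functions $f\in\mathcal{F}^{\rm Cheb}_\Lambda$ solely supported on $\Lambda$, by $$\widehat f_{\boldsymbol{k}}=\widehat f^{\,b}_{\boldsymbol{k}}:=Q_n^*\big(f(\cos(2\pi\,\bullet\,))\,\sqrt2^{\,|\boldsymbol{k}|_0}\cos(2\pi\boldsymbol{k}\cdot\,\bullet\,)\big)\qquad\text{for all }\boldsymbol{k}\in\Lambda,$$ if and only if $$\boldsymbol{\sigma}(\boldsymbol{k}')\cdot\boldsymbol{z}\not\equiv\boldsymbol{k}\cdot\boldsymbol{z}\pmod n\qquad\text{for all }\boldsymbol{k},\boldsymbol{k}'\in\Lambda,\ \boldsymbol{\sigma}\in\mathcal{S}_{\boldsymbol{k}'},\ \boldsymbol{\sigma}(\boldsymbol{k}')\ne\boldsymbol{k},$$ which is equivalent to $$\boldsymbol{h}\cdot\boldsymbol{z}\not\equiv0\pmod n\qquad\text{for all }\boldsymbol{h}\in(\Lambda\oplus\mathcal{M}(\Lambda))\setminus\{\boldsymbol{0}\}.$$ Such a generating vector $\boldsymbol{z}$ can be constructed component-by-component if $n$ is a prime satisfying $$n>\max\{\#(\Lambda\oplus\mathcal{M}(\Lambda)),\ 2\max(\Lambda)\}.$$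
   Context: Chebyshev basis on $[-1,1]^d$: $\eta_{\boldsymbol{k}}(\boldsymbol{x})=\sqrt2^{\,|\boldsymbol{k}|_0}\prod_{j=1}^dT_{k_j}(x_j)$, $\boldsymbol{k}\in\mathbb{N}_0^d$, $T_k(x)=\cos(k\arccos x)$, $|\boldsymbol{k}|_0$ the number of nonzero components. $\mathcal{F}^{\rm Cheb}_\Lambda$ is the set of real-valued functions $f=\sum_{\boldsymbol{k}\in\Lambda}\widehat f_{\boldsymbol{k}}\,\eta_{\boldsymbol{k}}$ on $[-1,1]^d$; the Chebyshev coefficients are $\widehat f_{\boldsymbol{k}}=\int_{[-1,1]^d}f\,\eta_{\boldsymbol{k}}\,\mu(d\boldsymbol{x})$ with $\mu(d\boldsymbol{x})=d\boldsymbol{x}/\prod_{j=1}^d(\pi\sqrt{1-x_j^2})$. The rank-1 lattice rule is $Q_n^*(g)=\frac1n\sum_{i=0}^{n-1}g\big(\frac{i\boldsymbol{z}\bmod n}{n}\big)$ (mod applied componentwise); $f(\cos(2\pi\,\bullet))$ denotes $\boldsymbol{x}\mapsto f(\cos(2\pi x_1),\ldots,\cos(2\pi x_d))$ and $\cos(2\pi\boldsymbol{k}\cdot\bullet)$ denotes $\boldsymbol{x}\mapsto\cos(2\pi\boldsymbol{k}\cdot\boldsymbol{x})$. $\boldsymbol{\sigma}(\boldsymbol{k})=(\sigma_1k_1,\ldots,\sigma_dk_d)$; $\mathcal{S}_{\boldsymbol{k}}=\{\boldsymbol{\sigma}\in\{\pm1\}^d:\sigma_j=+1\text{ if }k_j=0\}$;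 $\mathcal{M}(\Lambda)=\{\boldsymbol{\sigma}(\boldsymbol{k}):\boldsymbol{k}\in\Lambda,\boldsymbol{\sigma}\in\{\pm1\}^d\}$; $A\oplus B=\{\boldsymbol{a}+\boldsymbol{b}:\boldsymbol{a}\in A,\boldsymbol{b}\in B\}$; $\max(\Lambda)=\max_{\boldsymbol{k}\in\Lambda}\max_j|k_j|$; $\#$ is cardinality. "Constructed component-by-component": for an index set $\mathcal{A}\subset\mathbb{Z}^d$ (here $\mathcal{A}=\Lambda\oplus\mathcal{M}(\Lambda)$) and its projections $\mathcal{A}_s$, $s=1,\ldots,d$, given either by $\mathcal{A}_s=\{\boldsymbol{h}\in\mathbb{Z}^s:(\boldsymbol{h},\boldsymbol{0})\in\mathcal{A}\}$ or by $\mathcal{A}_s=\{\boldsymbol{h}\in\mathbb{Z}^s:(\boldsymbol{h},\boldsymbol{h}_\perp)\in\mathcal{A}\text{ for some }\boldsymbol{h}_\perp\}$, the components $z_1,\ldots,z_d\in\{1,\ldots,n-1\}$ can be chosen one at a time: whenever $z_1,\ldots,z_{s-1}$ satisfy $\boldsymbol{h}\cdot(z_1,\ldots,z_{s-1})\not\equiv0\pmod n$ for all $\boldsymbol{h}\in\mathcal{A}_{s-1}\setminus\{\boldsymbol{0}\}$ (no condition if $s=1$), there exists $z_s\in\{1,\ldots,n-1\}$ with $\boldsymbol{h}\cdot(z_1,\ldots,z_s)\not\equiv0\pmod n$ for all $\boldsymbol{h}\in\mathcal{A}_s\setminus\{\boldsymbol{0}\}$. Since $\mathcal{A}_d=\mathcal{A}$,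 the resulting $\boldsymbol{z}$ satisfies the required condition. *)

theory Defs
  imports "HOL-Analysis.Analysis" "HOL-Number_Theory.Cong"
begin

text \<open>
  A vector of length \<open>s\<close> is an extensional function on the index set \<open>{1..s}\<close>, matching the
  points of the product measure \<open>Pi\<^sub>M {1..s} M\<close>. The vectors of different lengths live in the same
  type, so componentwise operations restrict their result to \<open>{1..s}\<close>.
\<close>

abbreviation vecs :: "'a set \<Rightarrow> nat \<Rightarrow> (nat \<Rightarrow> 'a) set" where
  "vecs X s \<equiv> {1..s} \<rightarrow>\<^sub>E X"

definition zero_vec :: "nat \<Rightarrow> nat \<Rightarrow> int" where
  "zero_vec s = (\<lambda>j\<in>{1..s}. 0)"

definition int_dot :: "nat \<Rightarrow> (nat \<Rightarrow> int) \<Rightarrow> (nat \<Rightarrow> int) \<Rightarrow> int" where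
  "int_dot s h z = (\<Sum>j=1..s. h j * z j)"

definition sumset :: "nat \<Rightarrow> (nat \<Rightarrow> int) set \<Rightarrow> (nat \<Rightarrow> int) set \<Rightarrow> (nat \<Rightarrow> int) set" where
  "sumset d A B = {\<lambda>j\<in>{1..d}. a j + b j | a b. a \<in> A \<and> b \<in> B}"

definition append_vec :: "nat \<Rightarrow> nat \<Rightarrow> (nat \<Rightarrow> int) \<Rightarrow> (nat \<Rightarrow> int) \<Rightarrow> (nat \<Rightarrow> int)" where
  "append_vec s t h h' = (\<lambda>j\<in>{1..s + t}. if j \<le> s then h j else h' (j - s))"


text \<open>Multi-indices in \<open>\<nat>\<^sub>0\<^sup>d\<close> are represented as the nonnegative integer vectors \<open>vecs {0..} d\<close>, so
  that no coercion is needed between \<open>\<Lambda>\<close> and its mirrored set.\<close>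

definition signs :: "nat \<Rightarrow> (nat \<Rightarrow> int) set" where
  "signs d = vecs {1, -1} d"

definition sign_change :: "nat \<Rightarrow> (nat \<Rightarrow> int) \<Rightarrow> (nat \<Rightarrow> int) \<Rightarrow> (nat \<Rightarrow> int)" where
  "sign_change d \<sigma> k = (\<lambda>j\<in>{1..d}. \<sigma> j * k j)"

definition index_signs :: "nat \<Rightarrow> (nat \<Rightarrow> int) \<Rightarrow> (nat \<Rightarrow> int) set" where
  "index_signs d k = {\<sigma> \<in> signs d. \<forall>j\<in>{1..d}. k j = 0 \<longrightarrow> \<sigma> j = 1}"

definition mirrored :: "nat \<Rightarrow> (nat \<Rightarrow> int) set \<Rightarrow> (nat \<Rightarrow> int) set" where
  "mirrored d \<Lambda> = {sign_change d \<sigma> k | \<sigma> k. k \<in> \<Lambda> \<and> \<sigma> \<in> signs d}"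

text \<open>Inserting \<open>0\<close> only matters when there is no component at all, and fixes \<open>max(\<emptyset>) = 0\<close>.\<close>

definition max_index :: "nat \<Rightarrow> (nat \<Rightarrow> int) set \<Rightarrow> int" where
  "max_index d \<Lambda> = Max (insert 0 {\<bar>k j\<bar> | k j. k \<in> \<Lambda> \<and> j \<in> {1..d}})"

definition num_nonzero :: "nat \<Rightarrow> (nat \<Rightarrow> int) \<Rightarrow> nat" where
  "num_nonzero d k = card {j \<in> {1..d}. k j \<noteq> 0}"


definition cube :: "nat \<Rightarrow> (nat \<Rightarrow> real) set" where
  "cube d = vecs {-1..1} d"

definition cheb_T :: "int \<Rightarrow> real \<Rightarrow> real" where
  "cheb_T k x = cos (real_of_int k * arccos x)"

definition cheb_basis :: "nat \<Rightarrow> (nat \<Rightarrow> int) \<Rightarrow> (nat \<Rightarrow> real) \<Rightarrow> real" where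
  "cheb_basis d k x = sqrt 2 ^ num_nonzero d k * (\<Prod>j=1..d. cheb_T (k j) (x j))"

text \<open>Functions on \<open>[-1,1]\<^sup>d\<close> are total functions whose values outside the cube are unconstrained.\<close>

definition cheb_space :: "nat \<Rightarrow> (nat \<Rightarrow> int) set \<Rightarrow> ((nat \<Rightarrow> real) \<Rightarrow> real) set" where
  "cheb_space d \<Lambda> = {f. \<exists>c. \<forall>x\<in>cube d. f x = (\<Sum>k\<in>\<Lambda>. c k * cheb_basis d k x)}"

text \<open>On the faces \<open>\<bar>x j\<bar> = 1\<close>, a null set, the density is \<open>0\<close> by the convention for division.\<close>

definition cheb_measure :: "nat \<Rightarrow> (nat \<Rightarrow> real) measure" where
  "cheb_measure d = density (Pi\<^sub>M {1..d} (\<lambda>_. lborel))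
     (\<lambda>x. ennreal (indicator (cube d) x / (\<Prod>j=1..d. pi * sqrt (1 - (x j)\<^sup>2))))"

definition cheb_coeff :: "nat \<Rightarrow> ((nat \<Rightarrow> real) \<Rightarrow> real) \<Rightarrow> (nat \<Rightarrow> int) \<Rightarrow> real" where
  "cheb_coeff d f k = (LINT x:cube d|cheb_measure d. f x * cheb_basis d k x)"


definition lattice_rule ::
    "nat \<Rightarrow> nat \<Rightarrow> (nat \<Rightarrow> int) \<Rightarrow> ((nat \<Rightarrow> real) \<Rightarrow> real) \<Rightarrow> real" where
  "lattice_rule d n z g =
     (\<Sum>i = 0..<n. g (\<lambda>j\<in>{1..d}. real_of_int ((int i * z j) mod int n) / real n)) / real n"

definition lattice_coeff ::
    "nat \<Rightarrow> nat \<Rightarrow> (nat \<Rightarrow> int) \<Rightarrow> ((nat \<Rightarrow> real) \<Rightarrow> real) \<Rightarrow> (nat \<Rightarrow> int) \<Rightarrow> real" where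
  "lattice_coeff d n z f k = lattice_rule d n z
     (\<lambda>x. f (\<lambda>j\<in>{1..d}. cos (2 * pi * x j)) *
          (sqrt 2 ^ num_nonzero d k * cos (2 * pi * (\<Sum>j=1..d. real_of_int (k j) * x j))))"


definition admissible :: "nat \<Rightarrow> nat \<Rightarrow> (nat \<Rightarrow> int) set \<Rightarrow> (nat \<Rightarrow> int) \<Rightarrow> bool" where
  "admissible n s B z \<longleftrightarrow> (\<forall>h \<in> B - {zero_vec s}. \<not> [int_dot s h z = 0] (mod int n))"

text \<open>The two versions of the projections \<open>\<A>\<^sub>s\<close>, \<open>s \<le> d\<close>, of an index set \<open>\<A> \<subseteq> \<int>\<^sup>d\<close>.\<close>

definition zero_section :: "nat \<Rightarrow> (nat \<Rightarrow> int) set \<Rightarrow> nat \<Rightarrow> (nat \<Rightarrow> int) set" where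
  "zero_section d A s = {h \<in> vecs UNIV s. append_vec s (d - s) h (zero_vec (d - s)) \<in> A}"

definition full_projection :: "nat \<Rightarrow> (nat \<Rightarrow> int) set \<Rightarrow> nat \<Rightarrow> (nat \<Rightarrow> int) set" where
  "full_projection d A s =
     {h \<in> vecs UNIV s. \<exists>h' \<in> vecs UNIV (d - s). append_vec s (d - s) h h' \<in> A}"

text \<open>
  For the projections \<open>P s\<close> of \<open>A\<close>: every admissible choice of the first \<open>s - 1\<close> components extends
  to an admissible choice of \<open>s\<close> components; the vectors obtained in this way are admissible for
  \<open>A\<close> itself; and there is such a vector.
\<close>

definition cbc_constructible ::
    "nat \<Rightarrow> nat \<Rightarrow> (nat \<Rightarrow> int) set \<Rightarrow> (nat \<Rightarrow> (nat \<Rightarrow> int) set) \<Rightarrow> bool" where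
  "cbc_constructible d n A P \<longleftrightarrow>
     (\<forall>s\<in>{1..d}. \<forall>z \<in> vecs {1..int n - 1} (s - 1).
        (s = 1 \<or> admissible n (s - 1) (P (s - 1)) z) \<longrightarrow>
        (\<exists>z\<^sub>s \<in> {1..int n - 1}. admissible n s (P s) (z(s := z\<^sub>s)))) \<and>
     (\<forall>z \<in> vecs {1..int n - 1} d.
        (\<forall>s\<in>{1..d}. admissible n s (P s) (restrict z {1..s})) \<longrightarrow> admissible n d A z) \<and>
     (\<exists>z \<in> vecs {1..int n - 1} d.
        (\<forall>s\<in>{1..d}. admissible n s (P s) (restrict z {1..s})) \<and> admissible n d A z)"

end

theory Submission
  imports Defs
begin

text \<open>
  Substituting \<open>x = cos (2 \<pi> y)\<close> turns Chebyshev polynomials into cosines, and a product of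
  cosines is an average of exponentials over the sign changes of its frequency:
  \<open>\<eta> k'\<close> becomes \<open>sqrt 2 ^ |k'|\<^sub>0\<close> times the mean over \<open>\<sigma> \<in> index_signs d k'\<close> of
  \<open>exp (2 \<pi> i \<sigma>(k') \<cdot> y)\<close>. A rank-1 lattice rule integrates an exponential with frequency \<open>h\<close> to
  \<open>1\<close> if \<open>h \<cdot> z \<equiv> 0\<close> modulo \<open>n\<close>, and to \<open>0\<close> otherwise. Hence the lattice coefficient of \<open>\<eta> k'\<close> at
  \<open>k\<close> is a positive factor times the number of \<open>\<sigma>\<close> with \<open>\<sigma>(k') \<cdot> z \<equiv> k \<cdot> z\<close>; this is
  \<open>lattice_coeff_cheb_basis\<close>.

  The exact coefficients of \<open>f = \<Sum> c k * \<eta> k\<close> are the \<open>c k\<close>, because the Chebyshev basis is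
  orthonormal (\<open>cheb_coeff_eq\<close>). By linearity, exact reconstruction means that the lattice
  coefficient of \<open>\<eta> k'\<close> at \<open>k\<close> is \<open>1\<close> for \<open>k = k'\<close> and \<open>0\<close> otherwise. For \<open>k = k'\<close> the trivial
  sign change always contributes exactly \<open>1\<close>, so in all cases the requirement is that no
  \<open>\<sigma>\<close> with \<open>\<sigma>(k') \<noteq> k\<close> contributes. This is the separation condition, and moving
  \<open>\<sigma>(k')\<close> to the other side gives the condition on the sumset \<open>\<Lambda> \<oplus> M(\<Lambda>)\<close>.

  For the construction one counts bad choices of a new component. An index with nonzero last entry,
  which is also nonzero modulo the prime \<open>n\<close> because the entries of the sumset are bounded by twice the
  largest entry of \<open>\<Lambda>\<close>, forbids at most one of the \<open>n - 1\<close> candidates; an index with last entry zero is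
  handled by the components already chosen. The zero index forbids nothing, so there
  are at most \<open>n - 2\<close> forbidden candidates (\<open>exists_admissible_component\<close>).
\<close>

section \<open>Orthonormality of the Chebyshev basis\<close>

definition cheb_weight :: "real \<Rightarrow> real" where
  "cheb_weight x = indicator {-1..1} x / (pi * sqrt (1 - x\<^sup>2))"

lemma cheb_weight_nonneg: "0 \<le> cheb_weight x"
  by (auto simp: cheb_weight_def indicator_def abs_square_le_1 abs_le_iff)

lemma continuous_on_cheb_T: "continuous_on {-1..1} (cheb_T k)"
  unfolding cheb_T_def by (auto intro!: continuous_intros)

lemma cheb_T_times_cheb_T:
  "cheb_T a x * cheb_T b x = (cheb_T (a - b) x + cheb_T (a + b) x) / 2"
  by (simp add: cheb_T_def cos_times_cos algebra_simps)

lemma cheb_T_0 [simp]: "cheb_T 0 x = 1"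
  by (simp add: cheb_T_def)

lemma abs_cheb_T_le_1: "\<bar>cheb_T k x\<bar> \<le> 1"
  by (simp add: cheb_T_def)

text \<open>
  Up to the factor \<open>1 / \<pi>\<close>, the integrand is the derivative of \<open>- sin (m * arccos x) / m\<close> for
  \<open>m \<noteq> 0\<close>, which vanishes at both endpoints, and of \<open>- arccos x\<close> for \<open>m = 0\<close>. The derivative
  exists only in the interior, which suffices for the fundamental theorem of calculus.
\<close>

lemma has_integral_cheb_T:
  "((\<lambda>x. cheb_T m x / (pi * sqrt (1 - x\<^sup>2))) has_integral (if m = 0 then 1 else 0)) {-1..1}"
proof -
  define F where "F x = (if m = 0 then - arccos x / pi else - sin (of_int m * arccos x) / (of_int m * pi))"
    for x :: real
  have "((\<lambda>x. cheb_T m x / (pi * sqrt (1 - x\<^sup>2))) has_integral (F 1 - F (-1))) {-1..1}"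
  proof (rule fundamental_theorem_of_calculus_interior)
    show "continuous_on {-1..1} F"
      unfolding F_def by (cases "m = 0") (auto intro!: continuous_intros)
    fix x :: real assume x: "x \<in> {-1<..<1}"
    then have x_bounds: "-1 < x" "x < 1" by auto
    have "(F has_real_derivative cheb_T m x / (pi * sqrt (1 - x\<^sup>2))) (at x)"
      unfolding F_def cheb_T_def
      by (cases "m = 0") (auto intro!: derivative_eq_intros simp: x_bounds field_simps)
    then show "(F has_vector_derivative cheb_T m x / (pi * sqrt (1 - x\<^sup>2))) (at x)"
      by (simp add: has_real_derivative_iff_has_vector_derivative)
  qed simp
  also have "F 1 - F (-1) = (if m = 0 then 1 else 0)"
    by (auto simp: F_def mult.commute[of _ pi])
  finally show ?thesis .
qed

text \<open>
  The weight is nonnegative, so the existence of its gauge integral makes it Lebesgue integrable; since the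
  Chebyshev polynomials are bounded by \<open>1\<close> where the weight is nonzero, it dominates the other
  integrands, and the values of the integrals carry over.
\<close>

lemma has_bochner_integral_cheb_T:
  "has_bochner_integral lborel (\<lambda>x. cheb_weight x * cheb_T m x) (if m = 0 then 1 else 0)"
proof -
  have w: "cheb_weight \<in> borel_measurable borel" unfolding cheb_weight_def by measurable
  have "(\<lambda>x. 1 / (pi * sqrt (1 - x\<^sup>2))) absolutely_integrable_on {-1..1}"
    using has_integral_cheb_T[of 0]
    by (intro nonnegative_absolutely_integrable_1)
       (auto simp: has_integral_iff abs_square_le_1 abs_le_iff)
  then have "integrable lebesgue cheb_weight"
    by (simp add: set_integrable_def cheb_weight_def[abs_def])
  then have int_w: "integrable lborel cheb_weight"
    using w by (subst (asm) integrable_completion) auto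
  have "(\<lambda>x. cheb_weight x * (indicator {-1..1} x *\<^sub>R cheb_T m x)) \<in> borel_measurable borel"
    using w borel_measurable_continuous_on_indicator[OF _ continuous_on_cheb_T] by measurable
  also have "(\<lambda>x. cheb_weight x * (indicator {-1..1} x *\<^sub>R cheb_T m x))
      = (\<lambda>x. cheb_weight x * cheb_T m x)"
    by (auto simp: cheb_weight_def indicator_def)
  finally have int: "integrable lborel (\<lambda>x. cheb_weight x * cheb_T m x)"
    using cheb_weight_nonneg abs_cheb_T_le_1
    by (intro Bochner_Integration.integrable_bound[OF int_w])
       (auto simp: abs_mult mult_left_le)
  have "((\<lambda>x. cheb_weight x * cheb_T m x) has_integral (if m = 0 then 1 else 0)) UNIV"
    using has_integral_cheb_T[of m]
    by (subst (asm) has_integral_restrict_UNIV[symmetric])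
       (rule has_integral_eq[rotated], assumption, auto simp: cheb_weight_def)
  with has_integral_integral_lborel[OF int] int show ?thesis
    by (auto simp: has_bochner_integral_iff dest: has_integral_unique)
qed

lemma has_bochner_integral_cheb_T_mult:
  assumes "a \<ge> 0" "b \<ge> 0"
  shows "has_bochner_integral lborel (\<lambda>x. cheb_weight x * (cheb_T a x * cheb_T b x))
     (if a = b then if a = 0 then 1 else 1/2 else 0)"
proof -
  have "has_bochner_integral lborel
      (\<lambda>x. (cheb_weight x * cheb_T (a - b) x + cheb_weight x * cheb_T (a + b) x) / 2)
      (((if a - b = 0 then 1 else 0) + (if a + b = 0 then 1 else 0)) / 2)"
    by (intro has_bochner_integral_divide_zero has_bochner_integral_add has_bochner_integral_cheb_T)
  moreover have "(((if a - b = 0 then 1 else 0) + (if a + b = 0 then 1 else 0)) / 2 :: real)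
      = (if a = b then if a = 0 then 1 else 1/2 else 0)"
    using assms by auto
  ultimately show ?thesis
    by (simp add: cheb_T_times_cheb_T distrib_left del: One_nat_def)
qed

text \<open>
  The product form of the density is what reduces the orthogonality relations to dimension one.
\<close>

lemma cheb_density_eq_prod:
  assumes "x \<in> vecs UNIV d"
  shows "indicator (cube d) x / (\<Prod>j=1..d. pi * sqrt (1 - (x j)\<^sup>2)) = (\<Prod>j=1..d. cheb_weight (x j))"
proof -
  have "indicator (cube d) x = (\<Prod>j=1..d. indicator {-1..1} (x j) :: real)"
    using assms by (auto simp: cube_def indicator_def PiE_iff prod_zero_iff)
  then show ?thesis by (simp add: cheb_weight_def prod_dividef)
qed

text \<open>
  The product of the squared norms of the univariate Chebyshev polynomials, which the factor
  \<open>sqrt 2 ^ |k|\<^sub>0\<close> in the basis normalizes away.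
\<close>

lemma prod_half_num_nonzero:
  "(\<Prod>j=1..d. if k j = 0 then 1 else 1/2 :: real) = 1 / 2 ^ num_nonzero d k"
proof -
  have "(\<Prod>j=1..d. if k j = 0 then 1 else 1/2 :: real) = (\<Prod>j\<in>{j\<in>{1..d}. k j \<noteq> 0}. 1/2)"
    by (rule prod.mono_neutral_cong_right) auto
  then show ?thesis by (simp add: num_nonzero_def power_one_over)
qed

text \<open>
  With respect to Lebesgue measure, the integrand including the density is a product of functions of one
  coordinate each, so its integral is the product of the univariate ones. If \<open>k \<noteq> k'\<close>, a factor where
  they differ vanishes.
\<close>

lemma has_bochner_integral_cheb_basis_mult:
  assumes "k \<in> vecs {0..} d" "k' \<in> vecs {0..} d"
  shows "has_bochner_integral (cheb_measure d)
    (\<lambda>x. indicator (cube d) x *\<^sub>R (cheb_basis d k x * cheb_basis d k' x)) (if k = k' then 1 else 0)"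
proof -
  let ?M = "Pi\<^sub>M {1..d} (\<lambda>_. lborel :: real measure)"
  interpret product_sigma_finite "\<lambda>_::nat. lborel :: real measure" by standard
  define C where "C = sqrt 2 ^ num_nonzero d k * sqrt 2 ^ num_nonzero d k'"
  define g where "g j x = cheb_weight x * (cheb_T (k j) x * cheb_T (k' j) x)" for j x
  define w :: "(nat \<Rightarrow> real) \<Rightarrow> real"
    where "w x = indicator (cube d) x / (\<Prod>j=1..d. pi * sqrt (1 - (x j)\<^sup>2))" for x
  have nonneg: "k j \<ge> 0" "k' j \<ge> 0" if "j \<in> {1..d}" for j
    using assms that by (auto simp: PiE_iff)
  have g: "has_bochner_integral lborel (g j) (if k j = k' j then if k j = 0 then 1 else 1/2 else 0)"
    if "j \<in> {1..d}" for j
    unfolding g_def using that by (intro has_bochner_integral_cheb_T_mult nonneg)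
  have cube [measurable]: "cube d \<in> sets ?M"
    unfolding cube_def by (rule sets_PiM_I_finite) auto
  \<comment> \<open>\<open>cheb_T\<close> is continuous only on \<open>{-1..1}\<close>, as \<open>arccos\<close> is unspecified elsewhere; hence each
      coordinate carries its own indicator in the proof of measurability.\<close>
  have T [measurable]: "(\<lambda>x. indicator {-1..1} x * cheb_T m x) \<in> borel_measurable borel" for m
    using borel_measurable_continuous_on_indicator[OF _ continuous_on_cheb_T, of m] by simp
  have basis_indicator: "indicator (cube d) x * cheb_basis d m x
      = indicator (cube d) x * (sqrt 2 ^ num_nonzero d m * (\<Prod>j=1..d. indicator {-1..1} (x j) * cheb_T (m j) (x j)))"
    for m x
    by (auto simp: indicator_def cheb_basis_def cube_def PiE_iff intro!: prod.cong)
  have basis [measurable]: "(\<lambda>x. indicator (cube d) x * cheb_basis d m x) \<in> borel_measurable ?M" for m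
    unfolding basis_indicator by measurable
  have meas: "(\<lambda>x. indicator (cube d) x *\<^sub>R (cheb_basis d k x * cheb_basis d k' x)) \<in> borel_measurable ?M"
  proof -
    have "(\<lambda>x. (indicator (cube d) x * cheb_basis d k x) * (indicator (cube d) x * cheb_basis d k' x))
        \<in> borel_measurable ?M"
      by measurable
    then show ?thesis
      by (rule back_subst[where P = "\<lambda>f. f \<in> borel_measurable ?M"]) (auto simp: indicator_def)
  qed
  have "has_bochner_integral ?M (\<lambda>x. \<Prod>j=1..d. g j (x j))
     (\<Prod>j=1..d. if k j = k' j then if k j = 0 then 1 else 1/2 else 0)"
  proof -
    have "integrable lborel (g j)" "integral\<^sup>L lborel (g j) = (if k j = k' j then if k j = 0 then 1 else 1/2 else 0)"
      if "j \<in> {1..d}" for j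
      using g[OF that] by (auto simp: has_bochner_integral_iff)
    then show ?thesis
      unfolding has_bochner_integral_iff
      by (subst product_integral_prod) (auto intro!: product_integrable_prod prod.cong)
  qed
  also have "(\<Prod>j=1..d. if k j = k' j then if k j = 0 then 1 else 1/2 else 0 :: real)
      = (if k = k' then 1 / C else 0)"
  proof (cases "k = k'")
    case True
    then show ?thesis using prod_half_num_nonzero[where k = k and d = d]
      by (simp add: C_def power_mult_distrib[symmetric])
  next
    case False
    then obtain j where "j \<in> {1..d}" "k j \<noteq> k' j" using assms by (meson PiE_ext)
    then have "\<exists>j\<in>{1..d}. (if k j = k' j then if k j = 0 then 1 else 1/2 else 0 :: real) = 0" by (intro bexI[of _ j]) auto
    then show ?thesis using False by (auto intro!: prod_zero)
  qed
  finally have "has_bochner_integral ?M (\<lambda>x. C * (\<Prod>j=1..d. g j (x j))) (C * (if k = k' then 1 / C else 0))"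
    by (rule has_bochner_integral_mult_right)
  moreover have "C * (if k = k' then 1 / C else 0) = (if k = k' then 1 else 0)" by (simp add: C_def)
  moreover have "C * (\<Prod>j=1..d. g j (x j))
      = w x *\<^sub>R (indicator (cube d) x *\<^sub>R (cheb_basis d k x * cheb_basis d k' x))" if "x \<in> space ?M" for x
  proof -
    have "C * (\<Prod>j=1..d. g j (x j)) = (\<Prod>j=1..d. cheb_weight (x j)) * (cheb_basis d k x * cheb_basis d k' x)"
      by (simp add: g_def prod.distrib cheb_basis_def C_def)
    also have "(\<Prod>j=1..d. cheb_weight (x j)) = w x"
      unfolding w_def using that
      by (intro cheb_density_eq_prod[symmetric]) (simp add: space_PiM)
    also have "w x = w x * indicator (cube d) x" by (simp add: w_def indicator_def)
    finally show ?thesis by simp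
  qed
  ultimately have "has_bochner_integral ?M
      (\<lambda>x. w x *\<^sub>R (indicator (cube d) x *\<^sub>R (cheb_basis d k x * cheb_basis d k' x)))
      (if k = k' then 1 else 0)"
    by (simp cong: has_bochner_integral_cong)
  moreover have "w \<in> borel_measurable ?M" unfolding w_def by measurable
  moreover have "AE x in ?M. 0 \<le> w x"
  proof (rule AE_I2)
    fix x assume "x \<in> space ?M"
    then have "w x = (\<Prod>j=1..d. cheb_weight (x j))"
      unfolding w_def by (intro cheb_density_eq_prod) (simp add: space_PiM)
    then show "0 \<le> w x" by (simp add: prod_nonneg cheb_weight_nonneg)
  qed
  ultimately have "has_bochner_integral (density ?M w)
      (\<lambda>x. indicator (cube d) x *\<^sub>R (cheb_basis d k x * cheb_basis d k' x)) (if k = k' then 1 else 0)"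
    using meas by (intro has_bochner_integral_density)
  then show ?thesis by (simp add: cheb_measure_def w_def)
qed

lemma cheb_coeff_eq:
  assumes "finite \<Lambda>" "\<Lambda> \<subseteq> vecs {0..} d" "k \<in> \<Lambda>"
    and f: "\<And>x. x \<in> cube d \<Longrightarrow> f x = (\<Sum>k\<in>\<Lambda>. c k * cheb_basis d k x)"
  shows "cheb_coeff d f k = c k"
proof -
  have "has_bochner_integral (cheb_measure d)
     (\<lambda>x. \<Sum>k'\<in>\<Lambda>. c k' * (indicator (cube d) x *\<^sub>R (cheb_basis d k' x * cheb_basis d k x)))
     (\<Sum>k'\<in>\<Lambda>. c k' * (if k' = k then 1 else 0))"
    using assms
    by (intro has_bochner_integral_sum has_bochner_integral_mult_right has_bochner_integral_cheb_basis_mult)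
       auto
  moreover have "(\<Sum>k'\<in>\<Lambda>. c k' * (if k' = k then 1 else 0)) = c k"
    using assms by (simp add: if_distrib cong: if_cong)
  moreover have "(\<Sum>k'\<in>\<Lambda>. c k' * (indicator (cube d) x *\<^sub>R (cheb_basis d k' x * cheb_basis d k x)))
      = indicator (cube d) x *\<^sub>R (f x * cheb_basis d k x)" for x
    by (cases "x \<in> cube d") (simp_all add: f sum_distrib_right mult.assoc)
  ultimately show ?thesis
    by (simp add: cheb_coeff_def set_lebesgue_integral_def has_bochner_integral_iff)
qed

section \<open>Lattice rules applied to the Chebyshev basis\<close>

lemma cheb_T_cos: "cheb_T k (cos t) = cos (of_int k * t)"
proof -
  obtain m where m: "arccos (cos t) = \<bar>t - of_int m * (2 * pi)\<bar>"
    by (rule arccos_cos_eq_abs_2pi)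
  have "cos (c * \<bar>y\<bar>) = cos (c * y)" for c y :: real
    by (simp add: abs_if)
  then have "cheb_T k (cos t) = cos (of_int k * (t - of_int m * (2 * pi)))"
    unfolding cheb_T_def m .
  also have "\<dots> = cos (of_int k * t - (2 * pi) * of_int (k * m))"
    by (simp add: algebra_simps)
  also have "\<dots> = cos (of_int k * t)"
    by (simp only: cos_diff cos_int_2pin sin_int_2pin mult_1_right mult_zero_right add_0_right)
  finally show ?thesis .
qed

lemma cis_add_int_2pi: "cis (2 * pi * (x + of_int m)) = cis (2 * pi * x)"
  by (simp add: distrib_left flip: cis_mult)

lemma cis_sum: "finite A \<Longrightarrow> cis (\<Sum>x\<in>A. f x) = (\<Prod>x\<in>A. cis (f x))"
  by (induction A rule: finite_induct) (simp_all flip: cis_mult)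

lemma cis_2pi_eq_1_iff: "cis (2 * pi * x) = 1 \<longleftrightarrow> x \<in> \<int>"
proof
  assume "cis (2 * pi * x) = 1"
  then have "cos (2 * pi * x) = 1" by (metis cis.sel(1) one_complex.sel(1))
  then show "x \<in> \<int>" by (auto simp: cos_one_2pi_int)
qed simp

text \<open>
  With \<open>\<omega> = exp (2 \<pi> i a / n)\<close> this is a geometric sum, and \<open>(1 - \<omega>) * (\<Sum>i<n. \<omega> ^ i) = 1 - \<omega> ^ n = 0\<close>.
  So it vanishes unless \<open>\<omega> = 1\<close>.
\<close>

lemma sum_roots_of_unity:
  assumes "n \<ge> 1"
  shows "(\<Sum>i<n. cis (2 * pi * (of_int a * real i / real n)))
    = (if [a = 0] (mod int n) then of_nat n else 0)"
proof -
  define \<omega> where "\<omega> = cis (2 * pi * (of_int a / real n))"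
  have "(\<Sum>i<n. cis (2 * pi * (of_int a * real i / real n))) = (\<Sum>i<n. \<omega> ^ i)"
    unfolding \<omega>_def Complex.DeMoivre by (simp add: mult_ac)
  moreover have "\<omega> = 1 \<longleftrightarrow> [a = 0] (mod int n)"
  proof -
    have "of_int a / real n \<in> \<int> \<longleftrightarrow> int n dvd a"
      using assms of_int_div_of_int_in_Ints_iff[of a "int n", where ?'a = real] by simp
    then show ?thesis unfolding \<omega>_def cis_2pi_eq_1_iff cong_0_iff .
  qed
  moreover have "\<omega> ^ n = 1" using assms by (simp add: \<omega>_def Complex.DeMoivre cis_2pi_eq_1_iff)
  then have "(1 - \<omega>) * (\<Sum>i<n. \<omega> ^ i) = 0" by (metis cancel_comm_monoid_add_class.diff_cancel one_diff_power_eq)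
  ultimately show ?thesis by auto
qed

definition lattice_point :: "nat \<Rightarrow> nat \<Rightarrow> (nat \<Rightarrow> int) \<Rightarrow> nat \<Rightarrow> nat \<Rightarrow> real" where
  "lattice_point d n z i = (\<lambda>j\<in>{1..d}. real_of_int ((int i * z j) mod int n) / real n)"

definition real_dot :: "nat \<Rightarrow> (nat \<Rightarrow> int) \<Rightarrow> (nat \<Rightarrow> real) \<Rightarrow> real" where
  "real_dot d k x = (\<Sum>j=1..d. real_of_int (k j) * x j)"

text \<open>
  Reducing the components of \<open>i z / n\<close> modulo \<open>1\<close> changes the dot product by an integer, because the
  frequency \<open>h\<close> is integral.
\<close>

lemma cis_real_dot_lattice_point:
  assumes "n \<ge> 1"
  shows "cis (2 * pi * real_dot d h (lattice_point d n z i))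
    = cis (2 * pi * (of_int (int_dot d h z) * real i / real n))"
proof -
  have "real_of_int (int i * z j mod int n) / real n = real i * z j / n - of_int (int i * z j div int n)" for j
  proof -
    have "real_of_int (int i * z j mod int n) = real i * z j - n * of_int (int i * z j div int n)"
      by (subst minus_mult_div_eq_mod[symmetric]) simp
    then show ?thesis using assms by (simp add: field_simps)
  qed
  then have "real_dot d h (lattice_point d n z i)
      = of_int (int_dot d h z) * real i / real n + of_int (- (\<Sum>j=1..d. h j * (int i * z j div int n)))"
    by (simp add: real_dot_def lattice_point_def int_dot_def right_diff_distrib sum_subtractf
        sum_distrib_left sum_divide_distrib mult_ac)
  then show ?thesis by (simp only: cis_add_int_2pi)
qed

lemma lattice_character_average:
  assumes "n \<ge> 1"
  shows "(\<Sum>i=0..<n. cis (2 * pi * real_dot d h (lattice_point d n z i))) / of_nat n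
    = (if [int_dot d h z = 0] (mod int n) then 1 else 0)"
  using assms sum_roots_of_unity[OF assms, of "int_dot d h z"]
  by (simp add: cis_real_dot_lattice_point atLeast0LessThan)

lemma index_signs_eq_PiE:
  "index_signs d k = (\<Pi>\<^sub>E j\<in>{1..d}. if k j = 0 then {1} else {1, -1})"
  by (auto simp: index_signs_def signs_def PiE_iff extensional_def split: if_splits)

lemma finite_index_signs: "finite (index_signs d k)"
  unfolding index_signs_eq_PiE by (rule finite_PiE) auto

text \<open>
  Each factor with \<open>k j \<noteq> 0\<close> is the mean of two exponentials, and each factor with
  \<open>k j = 0\<close> is a single one; expanding the product ranges over exactly the signs in
  \<open>index_signs d k\<close>, without repetition.
\<close>

lemma prod_cos_eq_sum_cis:
  "complex_of_real (\<Prod>j=1..d. cos (2 * pi * (of_int (k j) * x j)))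
    = (\<Sum>\<sigma>\<in>index_signs d k. cis (2 * pi * real_dot d (sign_change d \<sigma> k) x)) / 2 ^ num_nonzero d k"
proof -
  define S :: "nat \<Rightarrow> int set" where "S j = (if k j = 0 then {1} else {1, -1})" for j
  define t where "t j = 2 * pi * (of_int (k j) * x j)" for j
  have "complex_of_real (cos (t j)) = (\<Sum>s\<in>S j. cis (of_int s * t j)) / of_nat (card (S j))" for j
    by (auto simp: S_def t_def complex_eq_iff)
  then have "complex_of_real (\<Prod>j=1..d. cos (t j))
      = (\<Prod>j=1..d. \<Sum>s\<in>S j. cis (of_int s * t j)) / (\<Prod>j=1..d. of_nat (card (S j)))"
    by (simp add: prod_dividef)
  also have "(\<Prod>j=1..d. \<Sum>s\<in>S j. cis (of_int s * t j))
      = (\<Sum>\<sigma>\<in>PiE {1..d} S. \<Prod>j=1..d. cis (of_int (\<sigma> j) * t j))"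
    by (rule prod_sum_PiE) (auto simp: S_def)
  also have "PiE {1..d} S = index_signs d k"
    by (simp add: index_signs_eq_PiE S_def[abs_def])
  also have "(\<Sum>\<sigma>\<in>index_signs d k. \<Prod>j=1..d. cis (of_int (\<sigma> j) * t j))
      = (\<Sum>\<sigma>\<in>index_signs d k. cis (2 * pi * real_dot d (sign_change d \<sigma> k) x))"
    by (simp add: cis_sum[symmetric] t_def real_dot_def sign_change_def sum_distrib_left mult_ac)
  also have "(\<Prod>j=1..d. of_nat (card (S j)) :: complex) = (\<Prod>j\<in>{j\<in>{1..d}. k j \<noteq> 0}. 2)"
    by (rule prod.mono_neutral_cong_right) (auto simp: S_def)
  also have "\<dots> = 2 ^ num_nonzero d k" by (simp add: num_nonzero_def)
  finally show ?thesis by (simp add: t_def)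
qed

text \<open>
  The product of cosines in \<open>\<eta> k'\<close> is real, so the factor \<open>cos (2 \<pi> k \<cdot> x)\<close> may be
  replaced by \<open>exp (- 2 \<pi> i k \<cdot> x)\<close> at the cost of taking the real part of the sum. Only the
  frequencies \<open>\<sigma>(k') - k\<close> then occur, instead of \<open>\<sigma>(k') - k\<close> and \<open>\<sigma>(k') + k\<close>.
\<close>

lemma lattice_coeff_cheb_basis:
  assumes "n \<ge> 1"
  shows "lattice_coeff d n z (cheb_basis d k') k =
     sqrt 2 ^ num_nonzero d k * sqrt 2 ^ num_nonzero d k' / 2 ^ num_nonzero d k' *
     card {\<sigma>\<in>index_signs d k'. [int_dot d (sign_change d \<sigma> k') z = int_dot d k z] (mod int n)}"
    (is "_ = _ * real (card ?S)")
proof -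
  let ?x = "lattice_point d n z"
  let ?D = "sqrt 2 ^ num_nonzero d k * sqrt 2 ^ num_nonzero d k'"
  define G where "G x = (\<Prod>j=1..d. cos (2 * pi * (of_int (k' j) * x j)))" for x
  define \<delta> where "\<delta> \<sigma> = (\<lambda>j. sign_change d \<sigma> k' j - k j)" for \<sigma>
  have factor: "of_real (G x) * cis (- (2 * pi * real_dot d k x))
      = (\<Sum>\<sigma>\<in>index_signs d k'. cis (2 * pi * real_dot d (\<delta> \<sigma>) x)) / 2 ^ num_nonzero d k'" for x
    unfolding G_def prod_cos_eq_sum_cis
    by (simp add: sum_distrib_right cis_mult \<delta>_def real_dot_def
        left_diff_distrib right_diff_distrib sum_subtractf)
  have "lattice_coeff d n z (cheb_basis d k') k
      = ?D * ((\<Sum>i=0..<n. G (?x i) * cos (2 * pi * real_dot d k (?x i))) / real n)"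
  proof -
    have basis: "cheb_basis d k' (\<lambda>j\<in>{1..d}. cos (2 * pi * y j)) = sqrt 2 ^ num_nonzero d k' * G y" for y
      unfolding cheb_basis_def G_def by (simp add: cheb_T_cos mult_ac)
    have "lattice_coeff d n z (cheb_basis d k') k
        = (\<Sum>i=0..<n. cheb_basis d k' (\<lambda>j\<in>{1..d}. cos (2 * pi * ?x i j)) *
            (sqrt 2 ^ num_nonzero d k * cos (2 * pi * real_dot d k (?x i)))) / real n"
      by (simp only: lattice_coeff_def lattice_rule_def lattice_point_def real_dot_def)
    then show ?thesis
      unfolding basis by (simp add: sum_distrib_left mult_ac)
  qed
  also have "(\<Sum>i=0..<n. G (?x i) * cos (2 * pi * real_dot d k (?x i))) / real n
      = Re ((\<Sum>i=0..<n. of_real (G (?x i)) * cis (- (2 * pi * real_dot d k (?x i)))) / of_nat n)"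
    by simp
  also have "(\<Sum>i=0..<n. of_real (G (?x i)) * cis (- (2 * pi * real_dot d k (?x i)))) / of_nat n
      = (\<Sum>\<sigma>\<in>index_signs d k'. (\<Sum>i=0..<n. cis (2 * pi * real_dot d (\<delta> \<sigma>) (?x i))) / of_nat n) / 2 ^ num_nonzero d k'"
    unfolding factor sum_divide_distrib by (subst sum.swap) (simp add: mult.commute)
  also have "\<dots> = (\<Sum>\<sigma>\<in>index_signs d k'. if [int_dot d (\<delta> \<sigma>) z = 0] (mod int n) then 1 else 0) / 2 ^ num_nonzero d k'"
    by (simp only: lattice_character_average[OF assms])
  also have "\<dots> = complex_of_real (card ?S / 2 ^ num_nonzero d k')"
  proof -
    have "int_dot d (\<delta> \<sigma>) z = int_dot d (sign_change d \<sigma> k') z - int_dot d k z" for \<sigma>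
      by (simp add: \<delta>_def int_dot_def left_diff_distrib sum_subtractf)
    then have "?S = index_signs d k' \<inter> {\<sigma>. [int_dot d (\<delta> \<sigma>) z = 0] (mod int n)}"
      by (simp only: cong_diff_iff_cong_0 Collect_conj_eq Collect_mem_eq)
    then show ?thesis by (simp add: sum.If_cases finite_index_signs)
  qed
  finally show ?thesis by (simp only: Re_complex_of_real times_divide_eq_right times_divide_eq_left)
qed

lemma lattice_coeff_sum:
  assumes f: "\<And>x. x \<in> cube d \<Longrightarrow> f x = (\<Sum>k\<in>\<Lambda>. c k * cheb_basis d k x)"
  shows "lattice_coeff d n z f k = (\<Sum>k'\<in>\<Lambda>. c k' * lattice_coeff d n z (cheb_basis d k') k)"
proof -
  have cube: "(\<lambda>j\<in>{1..d}. cos (t j)) \<in> cube d" for t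
    by (auto simp: cube_def)
  show ?thesis
    unfolding lattice_coeff_def lattice_rule_def f[OF cube] sum_divide_distrib sum_distrib_left sum_distrib_right
    by (subst sum.swap) (simp add: mult_ac)
qed

section \<open>Characterization of exact reconstruction\<close>

text \<open>
  Both indices are nonnegative, so no entry can have changed its sign, and \<open>index_signs\<close> leaves no
  choice of sign at the zero entries.
\<close>

lemma sign_change_eq_iff:
  assumes "k \<in> vecs {0..} d" "k' \<in> vecs {0..} d" "\<sigma> \<in> index_signs d k'"
  shows "sign_change d \<sigma> k' = k \<longleftrightarrow> k' = k \<and> \<sigma> = (\<lambda>j\<in>{1..d}. 1)"
proof
  assume eq: "sign_change d \<sigma> k' = k"
  have \<sigma>: "\<sigma> \<in> vecs {1, -1} d" "\<And>j. j \<in> {1..d} \<Longrightarrow> k' j = 0 \<Longrightarrow> \<sigma> j = 1"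
    using assms(3) by (simp_all add: index_signs_def signs_def)
  have pointwise: "\<sigma> j = 1 \<and> k' j = k j" if j: "j \<in> {1..d}" for j
  proof -
    have "\<sigma> j * k' j = k j" using fun_cong[OF eq, of j] j by (simp add: sign_change_def)
    moreover have "\<sigma> j = 1 \<or> \<sigma> j = -1" using PiE_mem[OF \<sigma>(1) j] by simp
    moreover have "k j \<ge> 0" "k' j \<ge> 0" using PiE_mem[OF assms(1) j] PiE_mem[OF assms(2) j] by simp_all
    ultimately show ?thesis using \<sigma>(2)[OF j] by auto
  qed
  have "k' = k" using assms(2,1) by (rule PiE_ext) (simp add: pointwise)
  moreover have "\<sigma> = (\<lambda>j\<in>{1..d}. 1)"
  proof
    fix j
    show "\<sigma> j = (\<lambda>j\<in>{1..d}. 1) j"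
      using PiE_arb[OF \<sigma>(1), of j] pointwise[of j] by (cases "j \<in> {1..d}") simp_all
  qed
  ultimately show "k' = k \<and> \<sigma> = (\<lambda>j\<in>{1..d}. 1)" ..
next
  assume "k' = k \<and> \<sigma> = (\<lambda>j\<in>{1..d}. 1)"
  moreover have "sign_change d (\<lambda>j\<in>{1..d}. 1) k = k"
  proof
    fix j
    show "sign_change d (\<lambda>j\<in>{1..d}. 1) k j = k j"
      using PiE_arb[OF assms(1), of j] by (cases "j \<in> {1..d}") (simp_all add: sign_change_def)
  qed
  ultimately show "sign_change d \<sigma> k' = k" by simp
qed

text \<open>
  Say that \<open>\<sigma>\<close> contributes if \<open>\<sigma>(k') \<cdot> z \<equiv> k \<cdot> z\<close> modulo \<open>n\<close>.
  For \<open>k' = k\<close> the coefficient is the number of contributing sign changes, among which the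
  trivial one always is; for \<open>k' \<noteq> k\<close> it vanishes iff there is none. By
  \<open>sign_change_eq_iff\<close>, both cases say that only sign changes with \<open>\<sigma>(k') = k\<close> contribute.
\<close>

lemma lattice_coeff_cheb_basis_eq_delta_iff:
  assumes n: "n \<ge> 1" and k: "k \<in> vecs {0..} d" and k': "k' \<in> vecs {0..} d"
  shows "lattice_coeff d n z (cheb_basis d k') k = (if k' = k then 1 else 0) \<longleftrightarrow>
    (\<forall>\<sigma> \<in> index_signs d k'. sign_change d \<sigma> k' \<noteq> k \<longrightarrow>
       \<not> [int_dot d (sign_change d \<sigma> k') z = int_dot d k z] (mod int n))"
proof -
  define S where
    "S = {\<sigma>\<in>index_signs d k'. [int_dot d (sign_change d \<sigma> k') z = int_dot d k z] (mod int n)}"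
  define one :: "nat \<Rightarrow> int" where "one = (\<lambda>j\<in>{1..d}. 1)"
  have fin: "finite S" unfolding S_def using finite_index_signs by simp
  have R: "lattice_coeff d n z (cheb_basis d k') k =
     sqrt 2 ^ num_nonzero d k * sqrt 2 ^ num_nonzero d k' / 2 ^ num_nonzero d k' * card S"
    unfolding S_def by (rule lattice_coeff_cheb_basis[OF n])
  have sep: "(\<forall>\<sigma> \<in> index_signs d k'. sign_change d \<sigma> k' \<noteq> k \<longrightarrow>
       \<not> [int_dot d (sign_change d \<sigma> k') z = int_dot d k z] (mod int n))
     \<longleftrightarrow> (\<forall>\<sigma>\<in>S. k' = k \<and> \<sigma> = one)"
    using sign_change_eq_iff[OF k k'] unfolding S_def one_def by blast
  show ?thesis
  proof (cases "k' = k")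
    case True
    have "one \<in> index_signs d k'" by (simp add: one_def index_signs_def signs_def)
    moreover from this have "sign_change d one k' = k"
      using sign_change_eq_iff[OF k k', of one] True by (simp add: one_def)
    ultimately have "one \<in> S" by (simp add: S_def)
    have "card S = 1 \<longleftrightarrow> (\<forall>\<sigma>\<in>S. \<sigma> = one)"
    proof
      assume "card S = 1"
      then obtain \<tau> where "S = {\<tau>}" by (rule card_1_singletonE)
      with \<open>one \<in> S\<close> show "\<forall>\<sigma>\<in>S. \<sigma> = one" by simp
    next
      assume "\<forall>\<sigma>\<in>S. \<sigma> = one"
      with \<open>one \<in> S\<close> have "S = {one}" by blast
      then show "card S = 1" by simp
    qed
    moreover have "lattice_coeff d n z (cheb_basis d k') k = card S"
      using R True by (simp add: power_mult_distrib[symmetric])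
    ultimately show ?thesis unfolding sep using True by simp
  next
    case False
    have "lattice_coeff d n z (cheb_basis d k') k = 0 \<longleftrightarrow> S = {}"
      unfolding R using fin by simp
    then show ?thesis unfolding sep using False by auto
  qed
qed

text \<open>
  Both the exact and the lattice coefficients depend linearly on \<open>f\<close>, so they need to be compared only
  on the basis functions, whose exact coefficients are known from orthonormality.
\<close>

lemma reconstruction_iff_separation:
  assumes n: "n \<ge> 1" and fin: "finite \<Lambda>" and \<Lambda>: "\<Lambda> \<subseteq> vecs {0..} d"
  shows "(\<forall>f \<in> cheb_space d \<Lambda>. \<forall>k\<in>\<Lambda>. cheb_coeff d f k = lattice_coeff d n z f k) \<longleftrightarrow>
    (\<forall>k\<in>\<Lambda>. \<forall>k'\<in>\<Lambda>. \<forall>\<sigma> \<in> index_signs d k'. sign_change d \<sigma> k' \<noteq> k \<longrightarrow>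
       \<not> [int_dot d (sign_change d \<sigma> k') z = int_dot d k z] (mod int n))"
    (is "?R \<longleftrightarrow> ?S")
proof -
  let ?L = "\<lambda>k k'. lattice_coeff d n z (cheb_basis d k') k"
  have "?S \<longleftrightarrow> (\<forall>k\<in>\<Lambda>. \<forall>k'\<in>\<Lambda>. ?L k k' = (if k' = k then 1 else 0))"
    using lattice_coeff_cheb_basis_eq_delta_iff[OF n] \<Lambda> by (simp add: subset_iff)
  moreover have "?R \<longleftrightarrow> (\<forall>k\<in>\<Lambda>. \<forall>k'\<in>\<Lambda>. ?L k k' = (if k' = k then 1 else 0))"
  proof (intro iffI ballI)
    fix k k' assume R: ?R and k: "k \<in> \<Lambda>" "k' \<in> \<Lambda>"
    have basis: "cheb_basis d k' x = (\<Sum>m\<in>\<Lambda>. (if m = k' then 1 else 0) * cheb_basis d m x)" for x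
      using fin k(2) by (simp add: if_distrib[of "\<lambda>c. c * _"] cong: if_cong)
    then have "cheb_basis d k' \<in> cheb_space d \<Lambda>"
      unfolding cheb_space_def by (intro CollectI exI[of _ "\<lambda>m. if m = k' then 1 else 0"] ballI)
    then have "?L k k' = cheb_coeff d (cheb_basis d k') k" using R k by simp
    also have "\<dots> = (if k = k' then 1 else 0)"
      by (rule cheb_coeff_eq[OF fin \<Lambda> k(1) basis])
    finally show "?L k k' = (if k' = k then 1 else 0)" by auto
  next
    fix f k assume L: "\<forall>k\<in>\<Lambda>. \<forall>k'\<in>\<Lambda>. ?L k k' = (if k' = k then 1 else 0)"
      and f: "f \<in> cheb_space d \<Lambda>" and k: "k \<in> \<Lambda>"
    from f obtain c where "\<forall>x\<in>cube d. f x = (\<Sum>k\<in>\<Lambda>. c k * cheb_basis d k x)"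
      unfolding cheb_space_def mem_Collect_eq by (elim exE)
    note c = bspec[OF this]
    have "lattice_coeff d n z f k = (\<Sum>k'\<in>\<Lambda>. c k' * ?L k k')"
      by (rule lattice_coeff_sum[OF c])
    also have "\<dots> = (\<Sum>k'\<in>\<Lambda>. if k' = k then c k' else 0)"
      using L k by (intro sum.cong) auto
    also have "\<dots> = c k" using fin k by simp
    also have "\<dots> = cheb_coeff d f k" by (rule cheb_coeff_eq[OF fin \<Lambda> k c, symmetric])
    finally show "cheb_coeff d f k = lattice_coeff d n z f k" by simp
  qed
  ultimately show ?thesis by simp
qed

text \<open>
  The elements of the sumset are the differences \<open>k - \<sigma>(k')\<close>, since \<open>\<sigma>\<close> may be replaced by
  \<open>- \<sigma>\<close>. Signs at zero entries of \<open>k'\<close> are irrelevant and can be normalized to \<open>1\<close>.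
\<close>

lemma separation_iff_admissible_sumset:
  assumes "\<Lambda> \<subseteq> vecs {0..} d"
  shows "(\<forall>k\<in>\<Lambda>. \<forall>k'\<in>\<Lambda>. \<forall>\<sigma> \<in> index_signs d k'. sign_change d \<sigma> k' \<noteq> k \<longrightarrow>
            \<not> [int_dot d (sign_change d \<sigma> k') z = int_dot d k z] (mod int n)) \<longleftrightarrow>
         admissible n d (sumset d \<Lambda> (mirrored d \<Lambda>)) z" (is "?A \<longleftrightarrow> _")
proof
  assume A: ?A
  show "admissible n d (sumset d \<Lambda> (mirrored d \<Lambda>)) z"
    unfolding admissible_def
  proof (intro ballI notI)
    fix h assume h: "h \<in> sumset d \<Lambda> (mirrored d \<Lambda>) - {zero_vec d}" "[int_dot d h z = 0] (mod int n)"
    then obtain k k' \<sigma> where k: "k \<in> \<Lambda>" "k' \<in> \<Lambda>" "\<sigma> \<in> signs d"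
      and h_eq: "h = (\<lambda>j\<in>{1..d}. k j + sign_change d \<sigma> k' j)"
      by (auto simp: sumset_def mirrored_def)
    define \<tau> where "\<tau> = (\<lambda>j\<in>{1..d}. if k' j = 0 then 1 else - \<sigma> j)"
    have \<tau>: "\<tau> \<in> index_signs d k'"
      using k(3) by (auto simp: \<tau>_def index_signs_def signs_def PiE_iff)
    have h_eq': "h = (\<lambda>j\<in>{1..d}. k j - sign_change d \<tau> k' j)"
      by (auto simp: h_eq sign_change_def \<tau>_def fun_eq_iff)
    have ne: "sign_change d \<tau> k' \<noteq> k"
      using h(1) by (auto simp: h_eq' zero_vec_def)
    have "int_dot d h z = int_dot d k z - int_dot d (sign_change d \<tau> k') z"
      by (simp add: h_eq' int_dot_def left_diff_distrib sum_subtractf)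
    with h(2) have "[int_dot d k z = int_dot d (sign_change d \<tau> k') z] (mod int n)"
      by (simp only: cong_diff_iff_cong_0)
    from cong_sym[OF this] show False
      using A[rule_format, OF k(1,2) \<tau> ne] by contradiction
  qed
next
  assume adm: "admissible n d (sumset d \<Lambda> (mirrored d \<Lambda>)) z"
  have ext: "k \<in> extensional {1..d}" if "k \<in> \<Lambda>" for k using assms that by (auto simp: PiE_def)
  show ?A
  proof (intro ballI impI notI)
    fix k k' \<sigma> assume k: "k \<in> \<Lambda>" "k' \<in> \<Lambda>" "\<sigma> \<in> index_signs d k'" "sign_change d \<sigma> k' \<noteq> k"
      and c: "[int_dot d (sign_change d \<sigma> k') z = int_dot d k z] (mod int n)"
    define \<tau> where "\<tau> = (\<lambda>j\<in>{1..d}. - \<sigma> j)"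
    define h where "h = (\<lambda>j\<in>{1..d}. k j + sign_change d \<tau> k' j)"
    have "\<tau> \<in> signs d"
      using k(3) by (auto simp: \<tau>_def index_signs_def signs_def PiE_iff)
    then have "h \<in> sumset d \<Lambda> (mirrored d \<Lambda>)"
      using k unfolding h_def sumset_def mirrored_def by blast
    moreover have "h \<noteq> zero_vec d"
    proof
      assume "h = zero_vec d"
      then have "sign_change d \<sigma> k' j = k j" if "j \<in> {1..d}" for j
      proof -
        have "h j = 0" using that \<open>h = zero_vec d\<close> by (simp add: zero_vec_def)
        with that show ?thesis by (simp add: h_def sign_change_def \<tau>_def)
      qed
      then have "sign_change d \<sigma> k' = k"
        using ext[OF k(1)] by (intro extensionalityI[of _ "{1..d}"]) (auto simp: sign_change_def)
      with k(4) show False ..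
    qed
    moreover have "int_dot d h z = int_dot d k z - int_dot d (sign_change d \<sigma> k') z"
      by (simp add: h_def int_dot_def sign_change_def \<tau>_def left_diff_distrib distrib_right sum_subtractf)
    then have "[int_dot d h z = 0] (mod int n)"
      using cong_sym[OF c] by (simp add: cong_diff_iff_cong_0)
    ultimately show False
      using adm unfolding admissible_def by blast
  qed
qed

section \<open>Component-by-component construction\<close>

lemma zero_vec_in_vecs: "zero_vec d \<in> vecs UNIV d"
  by (simp add: zero_vec_def)

lemma prime_cong_solutions_le_1:
  fixes a b :: int
  assumes "prime n" "\<not> int n dvd a"
  shows "card {x \<in> {1..int n - 1}. [b + a * x = 0] (mod int n)} \<le> 1" (is "card ?X \<le> 1")
proof -
  have "prime (int n)" using assms(1) by simp
  then have cop: "coprime a (int n)"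
    using assms(2) by (subst coprime_commute) (rule prime_imp_coprime)
  have uniq: "x = y" if x: "x \<in> ?X" and y: "y \<in> ?X" for x y
  proof -
    have "[b + a * x = 0] (mod int n)" "[b + a * y = 0] (mod int n)" using x y by blast+
    then have "[b + a * x = b + a * y] (mod int n)" by (metis cong_def)
    then have "[a * x = a * y] (mod int n)" by (rule cong_add_lcancel[THEN iffD1])
    then have "[x = y] (mod int n)" by (rule cong_mult_lcancel[OF cop, THEN iffD1])
    moreover have "0 \<le> x" "x < int n" "0 \<le> y" "y < int n" using x y by auto
    ultimately show ?thesis using cong_less_imp_eq_int by blast
  qed
  have "finite ?X" by (rule finite_subset[of _ "{1..int n - 1}"]) blast+
  then have "card ?X \<le> Suc 0" using uniq by (subst card_le_Suc0_iff_eq) blast+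
  then show ?thesis by simp
qed

lemma int_dot_upd:
  assumes "s \<ge> 1"
  shows "int_dot s h (z(s := v)) = int_dot (s - 1) h z + h s * v"
proof -
  obtain t where t: "s = Suc t" using assms by (cases s) auto
  have "(\<Sum>j=1..t. h j * (z(s := v)) j) = (\<Sum>j=1..t. h j * z j)"
    by (rule sum.cong) (auto simp: t)
  then show ?thesis by (simp add: int_dot_def t)
qed

lemma int_dot_cong:
  "(\<And>j. j \<in> {1..s} \<Longrightarrow> h j = h' j \<and> z j = z' j) \<Longrightarrow> int_dot s h z = int_dot s h' z'"
  by (simp add: int_dot_def)

text \<open>
  Only the indices \<open>h \<in> B\<close> with \<open>h s \<noteq> 0\<close> constrain the new component, and each of them forbids at
  most one value. If \<open>B\<close> is nonempty, there are at most \<open>card B - 1 \<le> n - 2\<close> of them because the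
  zero vector is an element of \<open>B\<close> that imposes no constraint. So one of the \<open>n - 1\<close> values is left.

  An index with \<open>h s = 0\<close> is covered by the admissibility for \<open>B'\<close>; for \<open>s = 1\<close> such an index is
  the zero vector.
\<close>

lemma exists_admissible_component:
  assumes n: "prime n" and s: "s \<ge> 1"
    and B: "finite B" "B \<subseteq> vecs UNIV s" "B \<noteq> {} \<Longrightarrow> zero_vec s \<in> B" "card B < n"
    and bound: "\<And>h. h \<in> B \<Longrightarrow> \<bar>h s\<bar> < int n"
    and B': "\<And>h. h \<in> B \<Longrightarrow> h s = 0 \<Longrightarrow> restrict h {1..s - 1} \<in> B'"
    and adm: "s = 1 \<or> admissible n (s - 1) B' z"
  shows "\<exists>v \<in> {1..int n - 1}. admissible n s B (z(s := v))"
proof -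
  define B1 where "B1 = {h \<in> B. h s \<noteq> 0}"
  define bad where "bad h = {v \<in> {1..int n - 1}. [int_dot (s - 1) h z + h s * v = 0] (mod int n)}" for h
  have n2: "n \<ge> 2" using n by (rule prime_ge_2_nat)
  have ndvd: "\<not> int n dvd h s" if "h \<in> B1" for h
    using bound[of h] that zdvd_imp_le[of "int n" "\<bar>h s\<bar>"] by (auto simp: B1_def)
  have fin: "finite B1" using B by (simp add: B1_def)
  have "card B1 < n - 1"
  proof (cases "B = {}")
    case False
    then have "B1 \<subseteq> B - {zero_vec s}"
      using s by (auto simp: B1_def zero_vec_def)
    then have "card B1 \<le> card B - 1"
      using B False by (metis card_Diff_singleton card_mono finite_Diff)
    moreover have "card B > 0" using B False by (simp add: card_gt_0_iff)
    ultimately show ?thesis using B(4) by simp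
  qed (use n2 in \<open>simp add: B1_def\<close>)
  moreover have "card (\<Union>h\<in>B1. bad h) \<le> (\<Sum>h\<in>B1. card (bad h))"
    by (rule card_UN_le[OF fin])
  moreover have "(\<Sum>h\<in>B1. card (bad h)) \<le> (\<Sum>h\<in>B1. 1)"
    unfolding bad_def by (intro sum_mono prime_cong_solutions_le_1 n ndvd)
  moreover have fin_bad: "finite (\<Union>h\<in>B1. bad h)"
  proof (rule finite_UN_I[OF fin])
    show "finite (bad h)" for h unfolding bad_def by (rule finite_Collect_conjI) simp
  qed
  ultimately have "card (\<Union>h\<in>B1. bad h) < card {1..int n - 1}" using n2 by simp
  then have "\<not> {1..int n - 1} \<subseteq> (\<Union>h\<in>B1. bad h)"
    using card_mono[OF fin_bad] by (meson leD)
  then obtain v where v: "v \<in> {1..int n - 1}" "\<And>h. h \<in> B1 \<Longrightarrow> v \<notin> bad h" by blast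
  have "admissible n s B (z(s := v))"
    unfolding admissible_def
  proof (intro ballI notI)
    fix h assume h: "h \<in> B - {zero_vec s}" "[int_dot s h (z(s := v)) = 0] (mod int n)"
    then have eq0: "[int_dot (s - 1) h z + h s * v = 0] (mod int n)" using s by (simp add: int_dot_upd)
    show False
    proof (cases "h s = 0")
      case True
      define h' where "h' = restrict h {1..s - 1}"
      have "int_dot (s - 1) h' z = int_dot (s - 1) h z" by (rule int_dot_cong) (simp add: h'_def)
      then have cong: "[int_dot (s - 1) h' z = 0] (mod int n)" using eq0 True by simp
      have h'_zero: "h' \<noteq> zero_vec (s - 1)"
      proof
        assume 0: "h' = zero_vec (s - 1)"
        have "h j = zero_vec s j" if "j \<in> {1..s}" for j
        proof (cases "j = s")
          case False
          then have j: "j \<in> {1..s - 1}" using that by auto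
          have "h' j = 0" using j by (simp add: 0 zero_vec_def)
          then show ?thesis using j that by (simp add: h'_def zero_vec_def)
        qed (use True that in \<open>simp add: zero_vec_def\<close>)
        then have "h = zero_vec s" using h(1) B(2) zero_vec_in_vecs by (intro PiE_ext[of h "{1..s}" "\<lambda>_. UNIV"]) auto
        with h show False by simp
      qed
      then have "s \<noteq> 1" by (auto simp: h'_def zero_vec_def)
      moreover have "h' \<in> B'" using B' h True by (simp add: h'_def)
      ultimately show False using adm cong h'_zero by (auto simp: admissible_def)
    next
      case False
      then show False using v h eq0 by (auto simp: B1_def bad_def)
    qed
  qed
  with v show ?thesis by blast
qed

text \<open>
  The hypotheses are what both kinds of projections have in common. The last one says that deleting a
  final entry zero leads into the next smaller projection.
\<close>

lemma cbc_constructibleI: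
  assumes n: "prime n"
    and A: "A \<subseteq> vecs UNIV d" 
    and P_d: "P d = A"
    and P: "\<And>s. s \<in> {1..d} \<Longrightarrow> P s \<subseteq> vecs UNIV s"
      "\<And>s. s \<in> {1..d} \<Longrightarrow> finite (P s) \<and> card (P s) < n"
      "\<And>s. s \<in> {1..d} \<Longrightarrow> P s \<noteq> {} \<Longrightarrow> zero_vec s \<in> P s"
      "\<And>s h. s \<in> {1..d} \<Longrightarrow> h \<in> P s \<Longrightarrow> \<bar>h s\<bar> < int n"
      "\<And>s h. s \<in> {1..d} \<Longrightarrow> h \<in> P s \<Longrightarrow> h s = 0 \<Longrightarrow> restrict h {1..s - 1} \<in> P (s - 1)"
  shows "cbc_constructible d n A P"
proof -
  have step: "\<exists>v \<in> {1..int n - 1}. admissible n s (P s) (z(s := v))"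
    if "s \<in> {1..d}" "s = 1 \<or> admissible n (s - 1) (P (s - 1)) z" for s z
    using that P by (intro exists_admissible_component[OF n, of s "P s" "P (s - 1)"]) auto
  have final: "admissible n d A z"
    if "z \<in> vecs {1..int n - 1} d" "\<forall>s\<in>{1..d}. admissible n s (P s) (restrict z {1..s})" for z
  proof (cases "d = 0")
    \<comment> \<open>In dimension \<open>0\<close> there is no projection to take the admissibility from, but the only vector is zero.\<close>
    case True
    then have "A \<subseteq> {zero_vec d}" using A by (auto simp: zero_vec_def restrict_def)
    then show ?thesis by (auto simp: admissible_def)
  next
    case False
    moreover have "restrict z {1..d} = z" using that(1) by (simp add: PiE_restrict)
    ultimately show ?thesis using that(2)[rule_format, of d] P_d by simp
  qed
  have exists: "\<exists>z \<in> vecs {1..int n - 1} t. \<forall>s\<in>{1..t}. admissible n s (P s) (restrict z {1..s})"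
    if "t \<le> d" for t
    using that
  proof (induction t)
    case 0
    show ?case by simp
  next
    case (Suc t)
    then obtain z where z: "z \<in> vecs {1..int n - 1} t"
      "\<And>s. s \<in> {1..t} \<Longrightarrow> admissible n s (P s) (restrict z {1..s})"
      using Suc.IH[OF Suc_leD[OF Suc.prems]] by blast
    have "Suc t = 1 \<or> admissible n (Suc t - 1) (P (Suc t - 1)) z"
      using z(2)[of t] PiE_restrict[OF z(1)] by (cases "t = 0") auto
    then obtain v where v: "v \<in> {1..int n - 1}" "admissible n (Suc t) (P (Suc t)) (z(Suc t := v))"
      using step[of "Suc t" z] Suc.prems by auto
    have mem: "z(Suc t := v) \<in> vecs {1..int n - 1} (Suc t)"
      using z(1) v(1) by (auto simp: PiE_iff extensional_def)
    moreover have "admissible n s (P s) (restrict (z(Suc t := v)) {1..s})" if "s \<in> {1..Suc t}" for s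
    proof (cases "s = Suc t")
      case True
      then show ?thesis using v(2) PiE_restrict[OF mem] by simp
    next
      case False
      then have "s \<in> {1..t}" "restrict (z(Suc t := v)) {1..s} = restrict z {1..s}"
        using that by (auto simp: restrict_def)
      then show ?thesis using z(2) by simp
    qed
    ultimately show ?case by blast
  qed
  show ?thesis
    unfolding cbc_constructible_def using exists[OF order_refl] step final by blast
qed

lemma restrict_append_vec:
  assumes "h \<in> vecs UNIV s"
  shows "restrict (append_vec s t h h') {1..s} = h"
proof
  fix j
  show "restrict (append_vec s t h h') {1..s} j = h j"
    using PiE_arb[OF assms, of j] by (cases "j \<in> {1..s}") (simp_all add: append_vec_def)
qed

lemma append_vec_restrict:
  assumes "s \<le> d" "a \<in> vecs UNIV d"
  shows "append_vec s (d - s) (restrict a {1..s}) (\<lambda>j\<in>{1..d - s}. a (s + j)) = a"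
proof
  fix j
  show "append_vec s (d - s) (restrict a {1..s}) (\<lambda>j\<in>{1..d - s}. a (s + j)) j = a j"
  proof (cases "j \<in> {s<..d}")
    case True
    then have "1 \<le> j - s" "j - s \<le> d - s" by auto
    with True show ?thesis by (simp add: append_vec_def)
  next
    case False
    then show ?thesis
      using assms PiE_arb[OF assms(2), of j] by (cases "j \<in> {1..d}") (simp_all add: append_vec_def)
  qed
qed

lemma full_projection_eq_image:
  assumes "s \<le> d" "A \<subseteq> vecs UNIV d"
  shows "full_projection d A s = (\<lambda>a. restrict a {1..s}) ` A"
proof (intro equalityI subsetI)
  fix h assume "h \<in> full_projection d A s"
  then have "h \<in> vecs UNIV s \<and> (\<exists>h'\<in>vecs UNIV (d - s). append_vec s (d - s) h h' \<in> A)"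
    by (simp only: full_projection_def mem_Collect_eq)
  then obtain h' where h: "h \<in> vecs UNIV s" "append_vec s (d - s) h h' \<in> A"
    by (elim conjE bexE)
  from h(2) have "restrict (append_vec s (d - s) h h') {1..s} \<in> (\<lambda>a. restrict a {1..s}) ` A"
    by (rule imageI)
  then show "h \<in> (\<lambda>a. restrict a {1..s}) ` A"
    by (simp only: restrict_append_vec[OF h(1)])
next
  fix h assume "h \<in> (\<lambda>a. restrict a {1..s}) ` A"
  then obtain a where a: "a \<in> A" "h = restrict a {1..s}" by auto
  have "h \<in> vecs UNIV s" using a by simp
  moreover have "append_vec s (d - s) h (\<lambda>j\<in>{1..d - s}. a (s + j)) \<in> A"
    using append_vec_restrict[of s d a] assms a by auto
  moreover have "(\<lambda>j\<in>{1..d - s}. a (s + j)) \<in> vecs UNIV (d - s)" by simp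
  ultimately show "h \<in> full_projection d A s"
    unfolding full_projection_def by (intro CollectI conjI bexI[of _ "\<lambda>j\<in>{1..d - s}. a (s + j)"])
qed

lemma zero_section_eq:
  assumes "s \<le> d" "A \<subseteq> vecs UNIV d"
  shows "zero_section d A s = {restrict a {1..s} | a. a \<in> A \<and> (\<forall>j\<in>{s<..d}. a j = 0)}"
proof (intro equalityI subsetI)
  fix h assume h: "h \<in> zero_section d A s"
  let ?a = "append_vec s (d - s) h (zero_vec (d - s))"
  have "?a \<in> A" "h \<in> vecs UNIV s" using h by (simp_all add: zero_section_def)
  moreover have "?a j = 0" if "j \<in> {s<..d}" for j
  proof -
    have "1 \<le> j - s" "j - s \<le> d - s" using that by auto
    with that show ?thesis by (simp add: append_vec_def zero_vec_def)
  qed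
  moreover have "h = restrict ?a {1..s}" using \<open>h \<in> vecs UNIV s\<close> by (simp only: restrict_append_vec)
  ultimately show "h \<in> {restrict a {1..s} | a. a \<in> A \<and> (\<forall>j\<in>{s<..d}. a j = 0)}" by blast
next
  fix h assume "h \<in> {restrict a {1..s} | a. a \<in> A \<and> (\<forall>j\<in>{s<..d}. a j = 0)}"
  then obtain a where a: "a \<in> A" "h = restrict a {1..s}" "\<forall>j\<in>{s<..d}. a j = 0" by auto
  have "zero_vec (d - s) = (\<lambda>j\<in>{1..d - s}. a (s + j))"
    unfolding zero_vec_def by (intro restrict_ext a(3)[rule_format, symmetric]) auto
  then show "h \<in> zero_section d A s"
    using append_vec_restrict[of s d a] assms a by (auto simp: zero_section_def)
qed

lemma sumset_subset_vecs: "sumset d A B \<subseteq> vecs UNIV d"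
  by (auto simp: sumset_def)

text \<open>
  The zero vector is \<open>k + (-k)\<close>.
\<close>

lemma zero_vec_in_sumset:
  assumes "k \<in> \<Lambda>"
  shows "zero_vec d \<in> sumset d \<Lambda> (mirrored d \<Lambda>)"
proof -
  have "(\<lambda>j\<in>{1..d}. -1) \<in> signs d" by (auto simp: signs_def)
  then have "sign_change d (\<lambda>j\<in>{1..d}. -1) k \<in> mirrored d \<Lambda>"
    using assms by (auto simp: mirrored_def)
  moreover have "zero_vec d = (\<lambda>j\<in>{1..d}. k j + sign_change d (\<lambda>j\<in>{1..d}. -1) k j)"
    by (auto simp: zero_vec_def sign_change_def fun_eq_iff)
  ultimately show ?thesis using assms unfolding sumset_def by blast
qed

lemma finite_sumset_mirrored:
  assumes "finite \<Lambda>"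
  shows "finite (sumset d \<Lambda> (mirrored d \<Lambda>))"
proof -
  have "finite (signs d)" unfolding signs_def by (rule finite_PiE) auto
  then have "finite ((\<lambda>(\<sigma>, k). sign_change d \<sigma> k) ` (signs d \<times> \<Lambda>))" using assms by simp
  also have "(\<lambda>(\<sigma>, k). sign_change d \<sigma> k) ` (signs d \<times> \<Lambda>) = mirrored d \<Lambda>"
    by (auto simp: mirrored_def image_iff)
  finally have "finite ((\<lambda>(a, b). \<lambda>j\<in>{1..d}. a j + b j) ` (\<Lambda> \<times> mirrored d \<Lambda>))" using assms by simp
  also have "(\<lambda>(a, b). \<lambda>j\<in>{1..d}. a j + b j) ` (\<Lambda> \<times> mirrored d \<Lambda>) = sumset d \<Lambda> (mirrored d \<Lambda>)"
    by (auto simp: sumset_def image_iff)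
  finally show ?thesis .
qed

lemma abs_le_max_index:
  assumes "finite \<Lambda>" "k \<in> \<Lambda>" "j \<in> {1..d}"
  shows "\<bar>k j\<bar> \<le> max_index d \<Lambda>"
proof -
  have "finite {\<bar>k j\<bar> | k j. k \<in> \<Lambda> \<and> j \<in> {1..d}}"
    using finite_image_set2[of "\<lambda>k. k \<in> \<Lambda>" "\<lambda>j. j \<in> {1..d}" "\<lambda>k j. \<bar>k j\<bar>"] assms by simp
  then show ?thesis unfolding max_index_def using assms by (intro Max_ge) auto
qed

lemma abs_sumset_mirrored_le:
  assumes "finite \<Lambda>" "h \<in> sumset d \<Lambda> (mirrored d \<Lambda>)" "j \<in> {1..d}"
  shows "\<bar>h j\<bar> \<le> 2 * max_index d \<Lambda>"
proof -
  obtain k k' \<sigma> where k: "k \<in> \<Lambda>" "k' \<in> \<Lambda>" "\<sigma> \<in> signs d"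
    and h: "h = (\<lambda>j\<in>{1..d}. k j + sign_change d \<sigma> k' j)"
    using assms by (auto simp: sumset_def mirrored_def)
  have "\<sigma> j = 1 \<or> \<sigma> j = -1" using k(3) assms(3) by (auto simp: signs_def PiE_iff)
  then have "\<bar>sign_change d \<sigma> k' j\<bar> = \<bar>k' j\<bar>"
    using assms(3) by (auto simp: sign_change_def)
  then show ?thesis
    using abs_le_max_index[OF assms(1) k(1) assms(3)] abs_le_max_index[OF assms(1) k(2) assms(3)] assms(3)
    by (simp add: h)
qed

text \<open>
  Both kinds of projections consist of restrictions of elements of \<open>A\<close>, which bounds their
  cardinality by that of \<open>A\<close>. In a zero section, an element with last entry zero remains one
  after deleting this entry, because the zero padding gets longer by one.
\<close>

lemma cbc_constructible_projections:
  assumes n: "prime n"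
    and A: "A \<subseteq> vecs UNIV d" "finite A" "card A < n" "A \<noteq> {} \<Longrightarrow> zero_vec d \<in> A"
    and bound: "\<And>h j. h \<in> A \<Longrightarrow> j \<in> {1..d} \<Longrightarrow> \<bar>h j\<bar> < int n"
  shows "cbc_constructible d n A (zero_section d A)" "cbc_constructible d n A (full_projection d A)"
proof -
  have restrict_id: "restrict a {1..d} = a" if "a \<in> A" for a
    using that A(1) by (auto intro: PiE_restrict)
  then have restrict_image: "(\<lambda>a. restrict a {1..d}) ` A = A" by (simp cong: image_cong)
  have restrict_zero: "restrict (zero_vec d) {1..s} = zero_vec s" if "s \<le> d" for s
    using that by (auto simp: zero_vec_def fun_eq_iff)
  have restrict_restrict: "restrict (restrict a {1..s}) {1..s - 1} = restrict a {1..s - 1}"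
    for a :: "nat \<Rightarrow> int" and s by (simp add: Int_absorb1)
  note full = full_projection_eq_image[OF _ A(1)] and zero = zero_section_eq[OF _ A(1)]
  have small: "finite Q \<and> card Q < n" if "Q \<subseteq> (\<lambda>a. restrict a {1..s}) ` A" for Q :: "(nat \<Rightarrow> int) set" and s
  proof -
    have "finite Q" using that A(2) by (meson finite_imageI finite_subset)
    moreover have "card Q \<le> card A" using that A(2) by (rule surj_card_le[rotated])
    ultimately show ?thesis using A(3) by simp
  qed
  show "cbc_constructible d n A (full_projection d A)"
  proof (rule cbc_constructibleI[OF n A(1)])
    show "full_projection d A d = A" by (simp only: full[OF order_refl] restrict_image)
  next
    fix s assume s: "s \<in> {1..d}"
    then have le: "s \<le> d" "s - 1 \<le> d" by auto
    note eq = full[OF le(1)] full[OF le(2)]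
    show "full_projection d A s \<subseteq> vecs UNIV s" by (auto simp: eq)
    show "finite (full_projection d A s) \<and> card (full_projection d A s) < n" by (rule small[of _ s]) (simp add: eq)
    show "zero_vec s \<in> full_projection d A s" if "full_projection d A s \<noteq> {}"
    proof -
      have "restrict (zero_vec d) {1..s} \<in> full_projection d A s"
        using that A(4) unfolding eq by (intro imageI) simp
      then show ?thesis unfolding restrict_zero[OF le(1)] .
    qed
    fix h assume h: "h \<in> full_projection d A s"
    then obtain a where a: "a \<in> A" "h = restrict a {1..s}" unfolding eq by (elim imageE)
    show "\<bar>h s\<bar> < int n" using a bound s by simp
    show "restrict h {1..s - 1} \<in> full_projection d A (s - 1)"
      unfolding eq a(2) restrict_restrict using a(1) by (rule imageI)
  qed
  show "cbc_constructible d n A (zero_section d A)"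
  proof (rule cbc_constructibleI[OF n A(1)])
    show "zero_section d A d = A" using restrict_image by (simp add: zero[OF order_refl] Setcompr_eq_image)
  next
    fix s assume s: "s \<in> {1..d}"
    then have le: "s \<le> d" "s - 1 \<le> d" by auto
    note eq = zero[OF le(1)] zero[OF le(2)]
    show "zero_section d A s \<subseteq> vecs UNIV s" by (auto simp: eq)
    show "finite (zero_section d A s) \<and> card (zero_section d A s) < n" by (rule small[of _ s]) (auto simp: eq)
    show "zero_vec s \<in> zero_section d A s" if "zero_section d A s \<noteq> {}"
    proof -
      have "zero_vec d \<in> A" using that A(4) by (auto simp: eq)
      moreover have "\<forall>j\<in>{s<..d}. zero_vec d j = 0" by (auto simp: zero_vec_def)
      moreover have "zero_vec s = restrict (zero_vec d) {1..s}" by (rule restrict_zero[OF le(1), symmetric])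
      ultimately show ?thesis unfolding eq by blast
    qed
    fix h assume "h \<in> zero_section d A s"
    then obtain a where a: "a \<in> A" "h = restrict a {1..s}" "\<forall>j\<in>{s<..d}. a j = 0" by (auto simp: eq)
    show "\<bar>h s\<bar> < int n" using a bound s by simp
    show "restrict h {1..s - 1} \<in> zero_section d A (s - 1)" if "h s = 0"
    proof -
      have "\<forall>j\<in>{s - 1<..d}. a j = 0"
      proof
        fix j assume "j \<in> {s - 1<..d}"
        then have "j = s \<or> j \<in> {s<..d}" by auto
        then show "a j = 0" using a that s by auto
      qed
      then show ?thesis using a(1) unfolding eq a(2) restrict_restrict by blast
    qed
  qed
qed

theorem lemma20:
  fixes d n :: nat and \<Lambda> :: "(nat \<Rightarrow> int) set"
  assumes "n \<ge> 1"
    and "finite \<Lambda>"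
    and "\<Lambda> \<subseteq> vecs {0..} d"
  shows
    "(\<forall>z \<in> vecs UNIV d.
        ((\<forall>f \<in> cheb_space d \<Lambda>. \<forall>k\<in>\<Lambda>. cheb_coeff d f k = lattice_coeff d n z f k) \<longleftrightarrow>
         (\<forall>k\<in>\<Lambda>. \<forall>k'\<in>\<Lambda>. \<forall>\<sigma> \<in> index_signs d k'. sign_change d \<sigma> k' \<noteq> k \<longrightarrow>
            \<not> [int_dot d (sign_change d \<sigma> k') z = int_dot d k z] (mod int n))) \<and>
        ((\<forall>k\<in>\<Lambda>. \<forall>k'\<in>\<Lambda>. \<forall>\<sigma> \<in> index_signs d k'. sign_change d \<sigma> k' \<noteq> k \<longrightarrow>
            \<not> [int_dot d (sign_change d \<sigma> k') z = int_dot d k z] (mod int n)) \<longleftrightarrow>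
         (\<forall>h \<in> sumset d \<Lambda> (mirrored d \<Lambda>) - {zero_vec d}.
            \<not> [int_dot d h z = 0] (mod int n)))) \<and>
     (prime n \<and> int n > max (int (card (sumset d \<Lambda> (mirrored d \<Lambda>)))) (2 * max_index d \<Lambda>) \<longrightarrow>
        cbc_constructible d n (sumset d \<Lambda> (mirrored d \<Lambda>))
          (zero_section d (sumset d \<Lambda> (mirrored d \<Lambda>))) \<and>
        cbc_constructible d n (sumset d \<Lambda> (mirrored d \<Lambda>))
          (full_projection d (sumset d \<Lambda> (mirrored d \<Lambda>))))"
proof -
  let ?A = "sumset d \<Lambda> (mirrored d \<Lambda>)"
  note A = sumset_subset_vecs[of d \<Lambda> "mirrored d \<Lambda>"] finite_sumset_mirrored[OF assms(2), of d]
  have zero: "zero_vec d \<in> ?A" if "?A \<noteq> {}"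
  proof -
    from that obtain k where "k \<in> \<Lambda>" by (auto simp: sumset_def)
    then show ?thesis by (rule zero_vec_in_sumset)
  qed
  have "cbc_constructible d n ?A (zero_section d ?A) \<and> cbc_constructible d n ?A (full_projection d ?A)"
    if "prime n" "int n > max (int (card ?A)) (2 * max_index d \<Lambda>)"
  proof -
    have "card ?A < n" using that(2) by simp
    moreover have "\<bar>h j\<bar> < int n" if "h \<in> ?A" "j \<in> {1..d}" for h j
      using abs_sumset_mirrored_le[OF assms(2) that] \<open>int n > max _ _\<close> by simp
    ultimately show ?thesis
      using cbc_constructible_projections[OF \<open>prime n\<close> A _ zero] by blast
  qed
  then show ?thesis
    using reconstruction_iff_separation[OF assms] separation_iff_admissible_sumset[OF assms(3)]
    unfolding admissible_def by blast
qed

end
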